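(* Let $\{\mu_n\}_{n\ge 1}$ be a sequence of probability measures on $\mathbb{Z}$ with asymptotically trivial transforms. Then there exist a subsequence $\{n_k\}$ and a constant $C<\infty$ such that for every $\varphi\in\ell^1(\mathbb{Z})$ and every $\lambda>0$, $$\left|\left\{x\in\mathbb{Z}:\sup_k |\varphi\ast\mu_{n_k}(x)|>\lambda\right\}\right|\leq C\lambda^{-1}\|\varphi\|_{\ell^1(\mathbb{Z})}.$$
   Context: Write $e(\gamma)=e^{2\pi i\gamma}$ and, for a measure $\mu$ on $\mathbb{Z}$, $\hat\mu(\gamma)=\sum_{j\in\mathbb{Z}}\mu(j)e(j\gamma)$ for $\gamma\in[0,1)$. A sequence $\{\mu_n\}$ of probability measures on $\mathbb{Z}$ has asymptotically trivial transforms if $\hat\mu_n$ converges to $0$ uniformly on every compact subset of $(0,1)$, or equivalently if $\sup_{\gamma\in[0,1)}|(1-e(\gamma))\hat\mu_n(\gamma)|\to 0$ as $n\to\infty$. Convolution is on $\mathbb{Z}$: $\varphi\ast\mu(x)=\sum_{j\in\mathbb{Z}}\varphi(x-j)\mu(j)$. $|A|$ denotes the cardinality of $A\subset\mathbb{Z}$. *)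

theory Defs
  imports "HOL-Probability.Probability"
begin

(* A probability measure on the integers is an int pmf; mu(j) is pmf \<mu> j. *)

definition e_unit :: "real \<Rightarrow> complex" where
  "e_unit \<gamma> = exp (2 * of_real pi * \<i> * of_real \<gamma>)"

definition fourier_Z :: "int pmf \<Rightarrow> real \<Rightarrow> complex" where
  "fourier_Z \<mu> \<gamma> = (\<Sum>\<^sub>\<infinity>j. of_real (pmf \<mu> j) * e_unit (of_int j * \<gamma>))"

definition asymp_trivial_transforms :: "(nat \<Rightarrow> int pmf) \<Rightarrow> bool" where
  "asymp_trivial_transforms \<mu> \<longleftrightarrow>
     (\<forall>K. compact K \<and> K \<subseteq> {0<..<1} \<longrightarrow>
        uniform_limit K (\<lambda>n. fourier_Z (\<mu> n)) (\<lambda>_. 0) sequentially)"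

definition ell1_Z :: "(int \<Rightarrow> complex) set" where
  "ell1_Z = {\<phi>. (\<lambda>x. norm (\<phi> x)) summable_on UNIV}"

definition ell1_norm :: "(int \<Rightarrow> complex) \<Rightarrow> real" where
  "ell1_norm \<phi> = (\<Sum>\<^sub>\<infinity>x. norm (\<phi> x))"

definition conv_Z :: "(int \<Rightarrow> complex) \<Rightarrow> int pmf \<Rightarrow> int \<Rightarrow> complex" where
  "conv_Z \<phi> \<mu> x = (\<Sum>\<^sub>\<infinity>j. \<phi> (x - j) * of_real (pmf \<mu> j))"

(* Taken in the extended reals, so that the supremum is meaningful without a boundedness proof. *)
definition maximal_fun :: "(nat \<Rightarrow> int pmf) \<Rightarrow> (int \<Rightarrow> complex) \<Rightarrow> int \<Rightarrow> ereal" where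
  "maximal_fun \<nu> \<phi> x = (SUP k. ereal (norm (conv_Z \<phi> (\<nu> k) x)))"

end

theory Submission
  imports Defs
begin

text \<open>Choose the subsequence together with scales $N_0 \le N_1 \le \dots$ such that $\mu_{n_k}$ has
almost all its mass in $[-N_{k+1}, N_{k+1}]$ and $(1 - e(\gamma))\hat\mu_{n_k}$ is small compared with
$1/N_k$. In the dyadic Calderon--Zygmund decomposition of $\varphi$ at height $\lambda$, the good part
is bounded. For the part of $\varphi$ living on a cube $Q$ there are three cases. If
$|Q| > N_{k+1}$, the convolution with $\mu_{n_k}$ stays near $Q$ up to a negligible tail. If
$N_k < |Q| \le N_{k+1}$, the trivial $\ell^1$ bound suffices, since this happens for at most one $k$.
If $|Q| \le N_k$, cancellation writes the bad part as $h(x) - h(x - 1)$ with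
$|h| \le 4 \lambda N_k$ supported on at most $\|\varphi\|_1 / \lambda$ points; moving the
difference to the measure, Parseval's identity bounds the convolution in $\ell^2$ by $\|h\|_2 / N_k$
times a summable factor.\<close>

section \<open>An $\ell^2$ bound from the Fourier transform\<close>

lemma norm_e_unit [simp]: "norm (e_unit \<gamma>) = 1"
proof -
  have "e_unit \<gamma> = cis (2 * pi * \<gamma>)" by (simp add: e_unit_def cis_conv_exp mult_ac)
  thus ?thesis by simp
qed

lemma e_unit_add: "e_unit (a + b) = e_unit a * e_unit b"
  by (simp add: e_unit_def exp_add[symmetric] algebra_simps)

lemma cnj_e_unit: "cnj (e_unit a) = e_unit (- a)"
  by (simp add: e_unit_def exp_cnj)

lemma e_unit_power: "e_unit a ^ n = e_unit (real n * a)"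
  by (simp add: e_unit_def exp_of_nat_mult[symmetric] algebra_simps)

lemma e_unit_eq_1_iff: "e_unit a = 1 \<longleftrightarrow> a \<in> \<int>"
proof -
  have "e_unit a = exp (2 * of_real pi * \<i> * of_real a)" by (simp add: e_unit_def)
  also have "\<dots> = 1 \<longleftrightarrow> (\<exists>n::int. 2 * pi * a = of_int (2 * n) * pi)"
    by (subst exp_eq_1) simp
  also have "\<dots> \<longleftrightarrow> (\<exists>n::int. a = of_int n)" by simp
  finally show ?thesis by (auto elim!: Ints_cases)
qed

text \<open>The terms are powers of an \<open>M\<close>-th root of unity, which is 1 exactly when
  \<open>M\<close> divides \<open>n\<close>; any other root makes the geometric sum vanish.\<close>

lemma sum_e_unit_roots:
  fixes n :: int
  assumes M: "M > 0"
  shows "(\<Sum>j<M. e_unit (of_int n * (real j / real M))) = (if int M dvd n then of_nat M else 0)"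
proof -
  define z where "z = e_unit (of_int n / real M)"
  have pw: "e_unit (of_int n * (real j / real M)) = z ^ j" for j
    by (simp add: z_def e_unit_power mult_ac)
  have z1: "z = 1 \<longleftrightarrow> int M dvd n"
  proof -
    have "of_int n / real M \<in> \<int> \<longleftrightarrow> int M dvd n"
    proof
      assume "of_int n / real M \<in> \<int>"
      then obtain k where "of_int n / real M = of_int k" by (auto elim: Ints_cases)
      hence "of_int n = (of_int (k * int M) :: real)" using M by (simp add: field_simps)
      thus "int M dvd n" by (simp only: of_int_eq_iff) simp
    next
      assume "int M dvd n"
      then obtain k where "n = int M * k" by (auto elim: dvdE)
      thus "of_int n / real M \<in> \<int>" using M by simp
    qed
    thus ?thesis by (simp add: z_def e_unit_eq_1_iff)
  qed
  have "z ^ M = e_unit (of_int n)" using M by (simp add: z_def e_unit_power)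
  hence zM: "z ^ M = 1" by (simp add: e_unit_eq_1_iff)
  show ?thesis
  proof (cases "z = 1")
    case True thus ?thesis using z1 by (simp add: pw del: times_divide_eq_right)
  next
    case False
    hence "(\<Sum>j<M. z ^ j) = 0" using zM by (simp add: geometric_sum)
    thus ?thesis using z1 False by (simp only: pw if_False)
  qed
qed

text \<open>Expanding the square and summing over the sample points \<open>j / M\<close> kills every
  off-diagonal term, because points of \<open>X\<close> that agree modulo \<open>M\<close> coincide.
  This finite identity replaces integration over the circle.\<close>

lemma discrete_parseval:
  fixes c :: "int \<Rightarrow> complex"
  assumes M: "M > 0" and X: "finite X"
    and inj: "\<And>x y. x \<in> X \<Longrightarrow> y \<in> X \<Longrightarrow> int M dvd x - y \<Longrightarrow> x = y"
  shows "(\<Sum>j<M. (norm (\<Sum>x\<in>X. c x * e_unit (of_int x * (real j / real M))))\<^sup>2)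
           = real M * (\<Sum>x\<in>X. (norm (c x))\<^sup>2)"
proof -
  have ep: "e_unit (g * of_int x) * e_unit (- (g * of_int y)) = e_unit (g * of_int (x - y))" for x y g
    by (simp add: e_unit_add[symmetric] algebra_simps)
  have sq: "complex_of_real ((norm (\<Sum>x\<in>X. c x * e_unit (of_int x * g)))\<^sup>2)
      = (\<Sum>x\<in>X. \<Sum>y\<in>X. c x * cnj (c y) * e_unit (of_int (x - y) * g))" for g
    unfolding complex_norm_square
    by (simp add: sum_product cnj_e_unit ep mult_ac del: of_int_diff)
  have "complex_of_real (\<Sum>j<M. (norm (\<Sum>x\<in>X. c x * e_unit (of_int x * (real j / real M))))\<^sup>2)
      = (\<Sum>j<M. \<Sum>x\<in>X. \<Sum>y\<in>X. c x * cnj (c y) * e_unit (of_int (x - y) * (real j / real M)))"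
    unfolding of_real_sum
    by (intro sum.cong refl sq)
  also have "\<dots> = (\<Sum>x\<in>X. \<Sum>j<M. \<Sum>y\<in>X. c x * cnj (c y) * e_unit (of_int (x - y) * (real j / real M)))"
    by (rule sum.swap)
  also have "\<dots> = (\<Sum>x\<in>X. \<Sum>y\<in>X. \<Sum>j<M. c x * cnj (c y) * e_unit (of_int (x - y) * (real j / real M)))"
    by (intro sum.cong refl sum.swap)
  also have "\<dots> = (\<Sum>x\<in>X. \<Sum>y\<in>X. c x * cnj (c y) * (if int M dvd x - y then of_nat M else 0))"
    by (simp only: sum_distrib_left[symmetric] sum_e_unit_roots[OF M])
  also have "\<dots> = (\<Sum>x\<in>X. \<Sum>y\<in>X. if x = y then of_nat M * (c x * cnj (c x)) else 0)"
    by (intro sum.cong refl) (use inj in auto)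
  also have "\<dots> = (\<Sum>x\<in>X. of_nat M * (c x * cnj (c x)))"
    using X by simp
  also have "\<dots> = complex_of_real (real M * (\<Sum>x\<in>X. (norm (c x))\<^sup>2))"
    by (simp only: complex_norm_square sum_distrib_left of_real_mult of_real_sum of_real_of_nat_eq)
  finally show ?thesis by (simp only: of_real_eq_iff)
qed

text \<open>The transform turns the convolution into a product, whose second factor is at most
  \<open>\<delta>\<close> at every sample point. Parseval is applied twice, to the convolution and
  to \<open>f\<close>.\<close>

lemma l2_convolution_bound:
  fixes f w :: "int \<Rightarrow> complex"
  assumes fin: "finite A" "finite B" "finite X"
    and w0: "\<And>z. z \<notin> B \<Longrightarrow> w z = 0"
    and bd: "\<And>\<gamma>. \<gamma> \<in> {0..<1} \<Longrightarrow> norm (\<Sum>z\<in>B. w z * e_unit (of_int z * \<gamma>)) \<le> \<delta>"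
  shows "(\<Sum>x\<in>X. (norm (\<Sum>y\<in>A. f y * w (x - y)))\<^sup>2) \<le> \<delta>\<^sup>2 * (\<Sum>y\<in>A. (norm (f y))\<^sup>2)"
proof -
  \<comment> \<open>\<open>Y\<close> contains the points to be summed over, the support of
    \<open>f\<close> and every point that the convolution can reach, so its transform may be
    computed on \<open>Y\<close>.\<close>
  define Y where "Y = X \<union> A \<union> (\<lambda>(y, z). y + z) ` (A \<times> B)"
  have Y: "finite Y" unfolding Y_def using fin by auto
  define R where "R = (\<Sum>y\<in>Y. \<bar>y\<bar>)"
  have R: "\<bar>y\<bar> \<le> R" if "y \<in> Y" for y
    unfolding R_def using Y that by (intro member_le_sum) auto
  \<comment> \<open>The modulus exceeds every difference of two points of \<open>Y\<close>, so
    sampling at \<open>M\<close> points causes no aliasing.\<close>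
  define M where "M = nat (2 * \<bar>R\<bar> + 1)"
  have M: "M > 0" "int M = 2 * \<bar>R\<bar> + 1" by (auto simp: M_def)
  have inj: "x = y" if "x \<in> Y" "y \<in> Y" "int M dvd x - y" for x y
  proof (rule ccontr)
    assume "x \<noteq> y"
    hence "int M \<le> \<bar>x - y\<bar>" using that(3) by (intro zdvd_imp_le) auto
    thus False using R[OF that(1)] R[OF that(2)] M by linarith
  qed
  define c where "c x = (\<Sum>y\<in>A. f y * w (x - y))" for x
  let ?g = "\<lambda>j. real j / real M"
  have shift: "(\<Sum>x\<in>Y. w (x - y) * e_unit (of_int x * g)) =
        e_unit (of_int y * g) * (\<Sum>z\<in>B. w z * e_unit (of_int z * g))" if "y \<in> A" for y g
  proof -
    have "(\<Sum>x\<in>Y. w (x - y) * e_unit (of_int x * g)) =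
          (\<Sum>x\<in>(\<lambda>z. y + z) ` B. w (x - y) * e_unit (of_int x * g))"
    proof (rule sum.mono_neutral_right[OF Y])
      show "(\<lambda>z. y + z) ` B \<subseteq> Y" using that by (auto simp: Y_def)
      show "\<forall>x\<in>Y - (\<lambda>z. y + z) ` B. w (x - y) * e_unit (of_int x * g) = 0"
      proof
        fix x assume "x \<in> Y - (\<lambda>z. y + z) ` B"
        hence "x - y \<notin> B" by (metis DiffD2 add_diff_cancel_left' diff_add_cancel add.commute image_eqI)
        thus "w (x - y) * e_unit (of_int x * g) = 0" using w0 by simp
      qed
    qed
    also have "\<dots> = (\<Sum>z\<in>B. w z * e_unit (of_int (y + z) * g))"
      by (subst sum.reindex) (auto simp: inj_on_def)
    also have "\<dots> = e_unit (of_int y * g) * (\<Sum>z\<in>B. w z * e_unit (of_int z * g))"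
      by (simp add: sum_distrib_left ring_distribs e_unit_add mult_ac)
    finally show ?thesis .
  qed
  have chat: "(\<Sum>x\<in>Y. c x * e_unit (of_int x * g)) =
     (\<Sum>y\<in>A. f y * e_unit (of_int y * g)) * (\<Sum>z\<in>B. w z * e_unit (of_int z * g))" for g
  proof -
    have "(\<Sum>x\<in>Y. c x * e_unit (of_int x * g)) = (\<Sum>x\<in>Y. \<Sum>y\<in>A. f y * (w (x - y) * e_unit (of_int x * g)))"
      by (simp add: c_def sum_distrib_right mult.assoc)
    also have "\<dots> = (\<Sum>y\<in>A. \<Sum>x\<in>Y. f y * (w (x - y) * e_unit (of_int x * g)))" by (rule sum.swap)
    also have "\<dots> = (\<Sum>y\<in>A. f y * (e_unit (of_int y * g) * (\<Sum>z\<in>B. w z * e_unit (of_int z * g))))"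
      by (intro sum.cong refl) (simp only: sum_distrib_left[symmetric] shift)
    also have "\<dots> = (\<Sum>y\<in>A. f y * e_unit (of_int y * g)) * (\<Sum>z\<in>B. w z * e_unit (of_int z * g))"
      by (simp add: sum_distrib_right mult_ac)
    finally show ?thesis .
  qed
  have "real M * (\<Sum>x\<in>Y. (norm (c x))\<^sup>2) = (\<Sum>j<M. (norm (\<Sum>x\<in>Y. c x * e_unit (of_int x * ?g j)))\<^sup>2)"
    by (rule discrete_parseval[symmetric]) (use M Y inj in auto)
  also have "\<dots> \<le> (\<Sum>j<M. \<delta>\<^sup>2 * (norm (\<Sum>y\<in>A. f y * e_unit (of_int y * ?g j)))\<^sup>2)"
  proof (rule sum_mono)
    fix j assume "j \<in> {..<M}"
    hence "?g j \<in> {0..<1}" by auto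
    hence "(norm (\<Sum>z\<in>B. w z * e_unit (of_int z * ?g j)))\<^sup>2 \<le> \<delta>\<^sup>2"
      by (intro power_mono bd) auto
    from mult_right_mono[OF this zero_le_power2[of "norm (\<Sum>y\<in>A. f y * e_unit (of_int y * ?g j))"]]
    show "(norm (\<Sum>x\<in>Y. c x * e_unit (of_int x * ?g j)))\<^sup>2 \<le>
            \<delta>\<^sup>2 * (norm (\<Sum>y\<in>A. f y * e_unit (of_int y * ?g j)))\<^sup>2"
      by (simp only: chat norm_mult power_mult_distrib mult.commute)
  qed
  also have "\<dots> = \<delta>\<^sup>2 * (real M * (\<Sum>y\<in>A. (norm (f y))\<^sup>2))"
    unfolding sum_distrib_left[symmetric]
    by (subst discrete_parseval) (use M fin inj in \<open>auto simp: Y_def\<close>)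
  finally have "(\<Sum>x\<in>Y. (norm (c x))\<^sup>2) \<le> \<delta>\<^sup>2 * (\<Sum>y\<in>A. (norm (f y))\<^sup>2)"
    using M(1) by (simp add: mult.left_commute)
  moreover have "(\<Sum>x\<in>X. (norm (c x))\<^sup>2) \<le> (\<Sum>x\<in>Y. (norm (c x))\<^sup>2)"
    by (rule sum_mono2) (use Y in \<open>auto simp: Y_def\<close>)
  ultimately show ?thesis unfolding c_def by linarith
qed

text \<open>Summation by parts moves the difference from \<open>h\<close> to \<open>m\<close>.
  Differencing \<open>m\<close> multiplies its transform by \<open>1 - e_unit \<gamma>\<close>, and
  this product is what asymptotic triviality makes small.\<close>

lemma l2_difference_convolution_bound:
  fixes b h m :: "int \<Rightarrow> complex"
  assumes fin: "finite S" "finite B" "finite X"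
    and b: "\<And>y. b y = h y - h (y - 1)"
    and supp: "\<And>y. y \<notin> S \<Longrightarrow> b y = 0" "\<And>y. y \<notin> S \<Longrightarrow> h y = 0" "\<And>z. z \<notin> B \<Longrightarrow> m z = 0"
    and bd: "\<And>\<gamma>. \<gamma> \<in> {0..<1} \<Longrightarrow>
        norm ((1 - e_unit \<gamma>) * (\<Sum>z\<in>B. m z * e_unit (of_int z * \<gamma>))) \<le> \<delta>"
  shows "(\<Sum>x\<in>X. (norm (\<Sum>y\<in>S. b y * m (x - y)))\<^sup>2) \<le> \<delta>\<^sup>2 * (\<Sum>y\<in>S. (norm (h y))\<^sup>2)"
proof -
  define w where "w z = m z - m (z - 1)" for z
  let ?s = "\<lambda>z::int. z + 1"
  have parts: "(\<Sum>y\<in>S. b y * m (x - y)) = (\<Sum>y\<in>S. h y * w (x - y))" for x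
  proof -
    \<comment> \<open>For \<open>y\<close> outside \<open>S\<close> both \<open>b y\<close> and
      \<open>h y\<close> vanish, hence so does \<open>h (y - 1)\<close>; the sum over
      \<open>S\<close> therefore loses no boundary term.\<close>
    have "(\<Sum>y\<in>S. h (y - 1) * m (x - y)) = (\<Sum>y\<in>S \<union> ?s ` S. h (y - 1) * m (x - y))"
      by (rule sum.mono_neutral_left) (use fin b supp in auto)
    also have "\<dots> = (\<Sum>y\<in>?s ` S. h (y - 1) * m (x - y))"
    proof (rule sum.mono_neutral_right)
      show "\<forall>i\<in>S \<union> ?s ` S - ?s ` S. h (i - 1) * m (x - i) = 0"
      proof
        fix i assume "i \<in> S \<union> ?s ` S - ?s ` S"
        hence "i - 1 \<notin> S" by (metis DiffD2 diff_add_cancel image_eqI)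
        thus "h (i - 1) * m (x - i) = 0" using supp by simp
      qed
    qed (use fin in auto)
    also have "\<dots> = (\<Sum>y\<in>S. h y * m (x - y - 1))"
      by (subst sum.reindex) (auto simp: inj_on_def algebra_simps)
    finally show ?thesis
      by (simp add: b w_def algebra_simps sum_subtractf)
  qed
  have what: "(\<Sum>z\<in>B \<union> ?s ` B. w z * e_unit (of_int z * g)) =
      (1 - e_unit g) * (\<Sum>z\<in>B. m z * e_unit (of_int z * g))" for g
  proof -
    have 1: "(\<Sum>z\<in>B \<union> ?s ` B. m z * e_unit (of_int z * g)) = (\<Sum>z\<in>B. m z * e_unit (of_int z * g))"
      by (rule sum.mono_neutral_right) (use fin supp in auto)
    have "(\<Sum>z\<in>B \<union> ?s ` B. m (z - 1) * e_unit (of_int z * g))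
        = (\<Sum>z\<in>?s ` B. m (z - 1) * e_unit (of_int z * g))"
    proof (rule sum.mono_neutral_right)
      show "\<forall>i\<in>B \<union> ?s ` B - ?s ` B. m (i - 1) * e_unit (of_int i * g) = 0"
      proof
        fix i assume "i \<in> B \<union> ?s ` B - ?s ` B"
        hence "i - 1 \<notin> B" by (metis DiffD2 diff_add_cancel image_eqI)
        thus "m (i - 1) * e_unit (of_int i * g) = 0" using supp by simp
      qed
    qed (use fin in auto)
    also have "\<dots> = e_unit g * (\<Sum>z\<in>B. m z * e_unit (of_int z * g))"
      by (subst sum.reindex) (auto simp: inj_on_def ring_distribs e_unit_add sum_distrib_left mult_ac)
    finally show ?thesis using 1
      by (simp add: w_def left_diff_distrib sum_subtractf)
  qed
  show ?thesis unfolding parts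
  proof (rule l2_convolution_bound)
    show "finite (B \<union> ?s ` B)" using fin by auto
    show "w z = 0" if "z \<notin> B \<union> ?s ` B" for z
    proof -
      have "z - 1 \<notin> B" using that by (metis UnCI diff_add_cancel image_eqI)
      thus ?thesis using that supp by (auto simp: w_def)
    qed
  qed (use fin bd what in auto)
qed

section \<open>The dyadic Calderon--Zygmund decomposition\<close>

lemma sum_le_ell1_norm:
  assumes "\<phi> \<in> ell1_Z" "finite F"
  shows "(\<Sum>x\<in>F. norm (\<phi> x)) \<le> ell1_norm \<phi>"
  using assms unfolding ell1_Z_def ell1_norm_def
  by (intro finite_sum_le_infsum) auto

section \<open>Dyadic intervals of integers and their nesting\<close>

definition dyadic :: "nat \<Rightarrow> int \<Rightarrow> int set" where
  "dyadic j x = {2 ^ j * (x div 2 ^ j)..<2 ^ j * (x div 2 ^ j) + 2 ^ j}"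

lemma mem_dyadic_iff: "y \<in> dyadic j x \<longleftrightarrow> y div 2 ^ j = x div 2 ^ j"
proof -
  have eq: "2 ^ j * (y div 2 ^ j) + y mod 2 ^ j = y" by simp
  have m: "0 \<le> y mod 2 ^ j" "y mod 2 ^ j < 2 ^ j" by simp_all
  show ?thesis
  proof
    assume "y \<in> dyadic j x"
    then obtain r where r: "y = 2 ^ j * (x div 2 ^ j) + r" "0 \<le> r" "r < 2 ^ j"
      unfolding dyadic_def by (auto intro!: that[of "y - 2 ^ j * (x div 2 ^ j)"])
    thus "y div 2 ^ j = x div 2 ^ j" by simp
  next
    assume "y div 2 ^ j = x div 2 ^ j"
    hence "y = 2 ^ j * (x div 2 ^ j) + y mod 2 ^ j" using eq by metis
    thus "y \<in> dyadic j x" using m unfolding dyadic_def atLeastLessThan_iff by linarith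
  qed
qed

lemma finite_dyadic [simp]: "finite (dyadic j x)"
  and card_dyadic [simp]: "card (dyadic j x) = 2 ^ j"
  by (simp_all add: dyadic_def nat_power_eq)

lemma self_mem_dyadic [simp]: "x \<in> dyadic j x"
  by (simp add: mem_dyadic_iff)

lemma dyadic_eq: "y \<in> dyadic j x \<Longrightarrow> dyadic j y = dyadic j x"
  unfolding mem_dyadic_iff by (simp add: dyadic_def)

text \<open>Division by \<open>2 ^ j\<close> factors through division by \<open>2 ^ i\<close>, so
  equal quotients at scale \<open>i\<close> remain equal at scale \<open>j\<close>.\<close>

lemma dyadic_mono: "i \<le> j \<Longrightarrow> dyadic i x \<subseteq> dyadic j x"
proof
  fix y assume ij: "i \<le> j" and y: "y \<in> dyadic i x"
  have "z div 2 ^ j = z div 2 ^ i div 2 ^ (j - i)" for z :: int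
    using ij zdiv_zmult2_eq[of "2 ^ (j - i)" z "2 ^ i"] by (simp flip: power_add)
  thus "y \<in> dyadic j x" using y by (simp add: mem_dyadic_iff)
qed

lemma dyadic_nested:
  assumes "z \<in> dyadic i x" "z \<in> dyadic j y" "i \<le> j"
  shows "dyadic i x \<subseteq> dyadic j y"
  using assms dyadic_mono[of i j x] dyadic_eq[of z i x] dyadic_eq[of z j y] dyadic_mono[of i j z] by simp

section \<open>The stopping-time decomposition at height \<open>s\<close>\<close>

locale calderon_zygmund =
  fixes \<phi> :: "int \<Rightarrow> complex" and s :: real
  assumes \<phi>: "\<phi> \<in> ell1_Z" and s: "s > 0"
begin

text \<open>Scales at which the dyadic average of \<open>norm \<phi>\<close> exceeds the height,
  with the denominator \<open>2 ^ j\<close> cleared.\<close>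

definition heavy :: "int \<Rightarrow> nat set" where
  "heavy x = {j. s * 2 ^ j < (\<Sum>y\<in>dyadic j x. norm (\<phi> y))}"

definition bad :: "int set" where
  "bad = {x. heavy x \<noteq> {}}"

text \<open>Taking the largest heavy scale selects maximal intervals directly. Off
  \<open>bad\<close> the maximum is over the empty set and its value carries no meaning.\<close>

definition level :: "int \<Rightarrow> nat" where
  "level x = Max (heavy x)"

definition cube :: "int \<Rightarrow> int set" where
  "cube x = dyadic (level x) x"

definition good_part :: "int \<Rightarrow> complex" where
  "good_part x = (if x \<in> bad then (\<Sum>y\<in>cube x. \<phi> y) / 2 ^ level x else \<phi> x)"

definition bad_part :: "int \<Rightarrow> complex" where
  "bad_part x = \<phi> x - good_part x"

text \<open>The discrete antiderivative of the bad part, restarted at the left end of every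
  cube.\<close>

definition primitive :: "int \<Rightarrow> complex" where
  "primitive x = (if x \<in> bad then (\<Sum>y\<in>cube x \<inter> {..x}. bad_part y) else 0)"

text \<open>A heavy scale has \<open>2 ^ j < ell1_norm \<phi> / s\<close>, so summability of
  \<open>\<phi>\<close> bounds the scales.\<close>

lemma finite_heavy [simp]: "finite (heavy x)"
proof -
  have "heavy x \<subseteq> {j. j < nat \<lceil>ell1_norm \<phi> / s\<rceil>}"
  proof
    fix j assume "j \<in> heavy x"
    hence "s * 2 ^ j < (\<Sum>y\<in>dyadic j x. norm (\<phi> y))" by (simp add: heavy_def)
    also have "\<dots> \<le> ell1_norm \<phi>" by (rule sum_le_ell1_norm[OF \<phi>]) simp
    finally have "2 ^ j < ell1_norm \<phi> / s" using s by (simp add: field_simps)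
    moreover have "real j < 2 ^ j" by (rule of_nat_less_two_power)
    ultimately have "real j < ell1_norm \<phi> / s" by linarith
    thus "j \<in> {j. j < nat \<lceil>ell1_norm \<phi> / s\<rceil>}" by (simp, linarith)
  qed
  thus ?thesis by (rule finite_subset) simp
qed

lemma heavy_le_level: "j \<in> heavy x \<Longrightarrow> j \<le> level x"
  by (simp add: level_def)

lemma level_heavy: "x \<in> bad \<Longrightarrow> level x \<in> heavy x"
  by (auto simp: level_def bad_def intro!: Max_in)

lemma heavy_dyadic: "y \<in> dyadic j x \<Longrightarrow> j \<in> heavy x \<Longrightarrow> j \<in> heavy y"
  by (simp add: heavy_def dyadic_eq)

lemma finite_cube [simp]: "finite (cube x)"
  and card_cube [simp]: "card (cube x) = 2 ^ level x"
  and self_mem_cube [simp]: "x \<in> cube x"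
  by (simp_all add: cube_def)

text \<open>The scale \<open>level x\<close> is heavy for \<open>y\<close> too, so
  \<open>level y\<close> is at least as large. The interval of \<open>y\<close> at its own level
  then contains \<open>x\<close>, and maximality at \<open>x\<close> forces equality. Hence two
  cubes are equal or disjoint.\<close>

lemma
  assumes x: "x \<in> bad" and y: "y \<in> cube x"
  shows cube_subset_bad: "y \<in> bad" and level_cube: "level y = level x" and cube_eq: "cube y = cube x"
proof -
  have lx: "level x \<in> heavy y" using heavy_dyadic level_heavy x y unfolding cube_def by blast
  thus b: "y \<in> bad" by (auto simp: bad_def)
  have le: "level x \<le> level y" using lx by (rule heavy_le_level)
  have "dyadic (level x) x \<subseteq> dyadic (level y) y"
    using y le unfolding cube_def by (intro dyadic_nested[of y]) auto
  hence "x \<in> dyadic (level y) y" by auto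
  hence "level y \<in> heavy x" using level_heavy[OF b] by (rule heavy_dyadic)
  hence "level y \<le> level x" by (rule heavy_le_level)
  with le show l: "level y = level x" by simp
  show "cube y = cube x" using y unfolding cube_def l by (rule dyadic_eq)
qed

text \<open>By maximality the dyadic parent of the cube is not heavy; it is twice as long, which
  gives the factor 2.\<close>

lemma sum_norm_cube_le:
  assumes "x \<in> bad"
  shows "(\<Sum>y\<in>cube x. norm (\<phi> y)) \<le> 2 * s * 2 ^ level x"
proof -
  have "Suc (level x) \<notin> heavy x" using heavy_le_level[of "Suc (level x)" x] by auto
  hence "(\<Sum>y\<in>dyadic (Suc (level x)) x. norm (\<phi> y)) \<le> s * 2 ^ Suc (level x)"
    by (simp add: heavy_def)
  moreover have "(\<Sum>y\<in>cube x. norm (\<phi> y)) \<le> (\<Sum>y\<in>dyadic (Suc (level x)) x. norm (\<phi> y))"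
    unfolding cube_def by (intro sum_mono2 dyadic_mono) auto
  ultimately show ?thesis by simp
qed

lemma norm_good_part_le: "norm (good_part x) \<le> 2 * s"
proof (cases "x \<in> bad")
  case True
  have "norm (\<Sum>y\<in>cube x. \<phi> y) \<le> 2 * s * 2 ^ level x"
    using sum_norm_cube_le[OF True] norm_sum order_trans by blast
  thus ?thesis using True by (simp add: good_part_def norm_divide norm_power field_simps)
next
  case False
  \<comment> \<open>At scale 0 the interval is the single point \<open>x\<close>, so failing to be
    heavy bounds \<open>\<phi> x\<close> itself.\<close>
  hence "0 \<notin> heavy x" by (auto simp: bad_def)
  moreover have "dyadic 0 x = {x}" by (auto simp: mem_dyadic_iff)
  ultimately have "norm (\<phi> x) \<le> s" by (simp add: heavy_def)
  thus ?thesis using False s by (simp add: good_part_def)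
qed

lemma bad_part_eq_0: "x \<notin> bad \<Longrightarrow> bad_part x = 0"
  by (simp add: bad_part_def good_part_def)

text \<open>On a cube the good part is constantly the mean of \<open>\<phi>\<close>, so both have
  the same sum there.\<close>

lemma sum_bad_part_cube:
  assumes "x \<in> bad"
  shows "(\<Sum>y\<in>cube x. bad_part y) = 0"
proof -
  have "(\<Sum>y\<in>cube x. good_part y) = (\<Sum>y\<in>cube x. (\<Sum>y\<in>cube x. \<phi> y) / 2 ^ level x)"
  proof (rule sum.cong[OF refl])
    fix y assume y: "y \<in> cube x"
    show "good_part y = (\<Sum>y\<in>cube x. \<phi> y) / 2 ^ level x"
      using cube_subset_bad[OF assms y] level_cube[OF assms y] cube_eq[OF assms y]
      by (simp add: good_part_def)
  qed
  thus ?thesis by (simp add: bad_part_def sum_subtractf)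
qed

lemma sum_norm_bad_part_cube_le:
  assumes "x \<in> bad"
  shows "(\<Sum>y\<in>cube x. norm (bad_part y)) \<le> 4 * s * 2 ^ level x"
proof -
  have "(\<Sum>y\<in>cube x. norm (bad_part y)) \<le> (\<Sum>y\<in>cube x. norm (\<phi> y) + 2 * s)"
    unfolding bad_part_def
    by (intro sum_mono order_trans[OF norm_triangle_ineq4] add_left_mono norm_good_part_le)
  also have "\<dots> = (\<Sum>y\<in>cube x. norm (\<phi> y)) + 2 * s * 2 ^ level x"
    by (simp add: sum.distrib)
  finally show ?thesis using sum_norm_cube_le[OF assms] by simp
qed

lemma norm_primitive_le: "x \<in> bad \<Longrightarrow> norm (primitive x) \<le> 4 * s * 2 ^ level x"
proof -
  assume x: "x \<in> bad"
  have "norm (primitive x) \<le> (\<Sum>y\<in>cube x \<inter> {..x}. norm (bad_part y))"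
    using x by (simp add: primitive_def sum_norm_le)
  also have "\<dots> \<le> (\<Sum>y\<in>cube x. norm (bad_part y))"
    by (intro sum_mono2) auto
  finally show ?thesis using sum_norm_bad_part_cube_le[OF x] by linarith
qed

text \<open>Here \<open>x\<close> is the last point of its cube, and the running sum has become the
  full sum, which is zero.\<close>

lemma primitive_right_end:
  assumes x: "x \<in> bad" and "x + 1 \<notin> cube x"
  shows "primitive x = 0"
proof -
  have "cube x \<inter> {..x} = cube x"
    using assms(2) self_mem_cube[of x] by (auto simp: cube_def dyadic_def)
  thus ?thesis using x by (simp add: primitive_def sum_bad_part_cube)
qed

text \<open>A condition on the level alone selects whole cubes, so the identity survives restriction
  to them. It is later applied to the cubes of length at most \<open>N k\<close>.\<close>

lemma primitive_diff:
  fixes P :: "nat \<Rightarrow> bool"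
  defines "S \<equiv> {x \<in> bad. P (level x)}"
  defines "h \<equiv> \<lambda>x. if x \<in> S then primitive x else 0"
  shows "(if x \<in> S then bad_part x else 0) = h x - h (x - 1)"
proof -
  have S_cube: "y \<in> S \<longleftrightarrow> x \<in> S" if "x \<in> bad" "y \<in> cube x" for x y
    using cube_subset_bad[OF that] level_cube[OF that] that by (simp add: S_def)
  \<comment> \<open>Nothing crosses a cube boundary: under this condition \<open>x - 1\<close> is
    either outside \<open>S\<close> or the right end of its own cube.\<close>
  have left: "h (x - 1) = 0" if "x \<in> S \<Longrightarrow> x - 1 \<notin> cube x"
  proof (cases "x - 1 \<in> S")
    case True
    hence b: "x - 1 \<in> bad" by (simp add: S_def)
    have "x \<notin> cube (x - 1)"
    proof
      assume x: "x \<in> cube (x - 1)"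
      hence "x \<in> S" using S_cube[OF b x] True by simp
      thus False using that cube_eq[OF b x] by simp
    qed
    thus ?thesis using True primitive_right_end[OF b] by (simp add: h_def)
  qed (simp add: h_def)
  show ?thesis
  proof (cases "x \<in> S")
    case False
    thus ?thesis using left by (simp add: h_def)
  next
    case True
    hence b: "x \<in> bad" by (simp add: S_def)
    show ?thesis
    proof (cases "x - 1 \<in> cube x")
      case inside: True
      have "x - 1 \<in> bad" "cube (x - 1) = cube x" "x - 1 \<in> S"
        using cube_subset_bad[OF b inside] cube_eq[OF b inside] S_cube[OF b inside] True by auto
      moreover have "cube x \<inter> {..x} = insert x (cube x \<inter> {..x - 1})"
        by auto
      ultimately show ?thesis using True b by (simp add: h_def primitive_def)
    next
      case False
      hence "cube x \<inter> {..x} = {x}"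
        using self_mem_cube[of x] by (auto simp: cube_def dyadic_def)
      thus ?thesis using True b False left by (simp add: h_def primitive_def)
    qed
  qed
qed

text \<open>Distinct cubes are disjoint, and on each the mass of \<open>\<phi>\<close> exceeds
  \<open>s\<close> times its size. The count is made for finite subsets \<open>F\<close> first, and
  their uniform bound yields finiteness of \<open>bad\<close>.\<close>

lemma finite_bad: "finite bad" and card_bad_le: "real (card bad) \<le> ell1_norm \<phi> / s"
proof -
  have "card F \<le> nat \<lfloor>ell1_norm \<phi> / s\<rfloor>" if F: "F \<subseteq> bad" "finite F" for F
  proof -
    define \<Q> where "\<Q> = cube ` F"
    have fin: "finite \<Q>" "\<And>Q. Q \<in> \<Q> \<Longrightarrow> finite Q" unfolding \<Q>_def using F by auto
    have disj: "pairwise disjnt \<Q>"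
    proof (rule pairwiseI)
      fix P Q assume "P \<in> \<Q>" "Q \<in> \<Q>" "P \<noteq> Q"
      then obtain x y where "x \<in> bad" "y \<in> bad" "P = cube x" "Q = cube y"
        unfolding \<Q>_def using F by auto
      thus "disjnt P Q" using cube_eq \<open>P \<noteq> Q\<close> unfolding disjnt_iff by metis
    qed
    have "s * real (card F) \<le> s * real (card (\<Union>\<Q>))"
    proof -
      have "F \<subseteq> \<Union>\<Q>" unfolding \<Q>_def using self_mem_cube by auto
      hence "card F \<le> card (\<Union>\<Q>)" using fin by (intro card_mono) auto
      thus ?thesis using s by simp
    qed
    also have "\<dots> = (\<Sum>Q\<in>\<Q>. s * real (card Q))"
      using card_Union_disjoint[OF disj fin(2)] by (simp add: sum_distrib_left)
    also have "\<dots> \<le> (\<Sum>Q\<in>\<Q>. \<Sum>y\<in>Q. norm (\<phi> y))"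
    proof (rule sum_mono)
      fix Q assume "Q \<in> \<Q>"
      then obtain x where "x \<in> bad" "Q = cube x" using F by (auto simp: \<Q>_def)
      thus "s * real (card Q) \<le> (\<Sum>y\<in>Q. norm (\<phi> y))"
        using level_heavy[of x] by (simp add: heavy_def cube_def)
    qed
    also have "\<dots> = (\<Sum>y\<in>\<Union>\<Q>. norm (\<phi> y))"
      using fin disj by (subst sum.Union_disjoint) (auto simp: pairwise_def disjnt_def)
    also have "\<dots> \<le> ell1_norm \<phi>"
      using fin by (intro sum_le_ell1_norm \<phi>) auto
    finally have "real (card F) \<le> ell1_norm \<phi> / s" using s by (simp add: field_simps)
    thus ?thesis by linarith
  qed
  hence *: "finite bad \<and> card bad \<le> nat \<lfloor>ell1_norm \<phi> / s\<rfloor>"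
    by (rule finite_if_finite_subsets_card_bdd)
  thus "finite bad" by simp
  have "0 \<le> ell1_norm \<phi> / s"
    using s by (simp add: ell1_norm_def infsum_nonneg)
  thus "real (card bad) \<le> ell1_norm \<phi> / s" using * by linarith
qed

text \<open>The exceptional set: a point outside it is farther from each bad point than the length
  of the cube there, so a measure supported within that length cannot reach it.\<close>

definition enlarged :: "int set" where
  "enlarged = {x. \<exists>y\<in>bad. \<bar>x - y\<bar> \<le> 2 ^ level y}"

text \<open>A point within one cube length of \<open>y\<close> lies in the cube of \<open>y\<close>
  or in one of the two adjacent translates. As the level is constant on cubes, the translates are
  images of \<open>bad\<close>, giving at most three times its size.\<close>

lemma enlarged_subset:
  "enlarged \<subseteq> bad \<union> (\<lambda>z. z + 2 ^ level z) ` bad \<union> (\<lambda>z. z - 2 ^ level z) ` bad"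
proof
  fix x assume "x \<in> enlarged"
  then obtain y where y: "y \<in> bad" "\<bar>x - y\<bar> \<le> 2 ^ level y" by (auto simp: enlarged_def)
  define L :: int where "L = 2 ^ level y"
  define a where "a = L * (y div L)"
  have cu: "cube y = {a..<a + L}" by (simp add: cube_def dyadic_def a_def L_def)
  have "y \<in> {a..<a + L}" using self_mem_cube[of y] cu by simp
  hence "x \<in> cube y \<or> x - L \<in> cube y \<or> x + L \<in> cube y"
    using y(2) unfolding cu L_def[symmetric] atLeastLessThan_iff by linarith
  thus "x \<in> bad \<union> (\<lambda>z. z + 2 ^ level z) ` bad \<union> (\<lambda>z. z - 2 ^ level z) ` bad"
  proof (elim disjE)
    assume "x \<in> cube y" thus ?thesis using cube_subset_bad[OF y(1)] by auto
  next
    assume c: "x - L \<in> cube y"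
    have "x = (x - L) + 2 ^ level (x - L)"
      unfolding level_cube[OF y(1) c] L_def[symmetric] by simp
    hence "x \<in> (\<lambda>z. z + 2 ^ level z) ` bad" using cube_subset_bad[OF y(1) c] by (rule image_eqI)
    thus ?thesis by simp
  next
    assume c: "x + L \<in> cube y"
    have "x = (x + L) - 2 ^ level (x + L)"
      unfolding level_cube[OF y(1) c] L_def[symmetric] by simp
    hence "x \<in> (\<lambda>z. z - 2 ^ level z) ` bad" using cube_subset_bad[OF y(1) c] by (rule image_eqI)
    thus ?thesis by simp
  qed
qed

lemma finite_enlarged: "finite enlarged"
  and card_enlarged_le: "real (card enlarged) \<le> 3 * ell1_norm \<phi> / s"
proof -
  let ?U = "bad \<union> (\<lambda>z. z + 2 ^ level z) ` bad \<union> (\<lambda>z. z - 2 ^ level z) ` bad"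
  have fin: "finite ?U" using finite_bad by auto
  thus "finite enlarged" using enlarged_subset by (rule rev_finite_subset)
  have "card enlarged \<le> card ?U" using fin enlarged_subset by (rule card_mono)
  also have "\<dots> \<le> card bad + card bad + card bad"
    by (intro order_trans[OF card_Un_le] add_mono card_image_le finite_bad order_refl)
  finally show "real (card enlarged) \<le> 3 * ell1_norm \<phi> / s" using card_bad_le by simp
qed

text \<open>One copy of the norm comes from \<open>\<phi>\<close>; two more come from the good part,
  bounded by \<open>2 * s\<close> on at most \<open>ell1_norm \<phi> / s\<close> points.\<close>

lemma sum_norm_bad_part_le: "(\<Sum>y\<in>bad. norm (bad_part y)) \<le> 3 * ell1_norm \<phi>"
proof -
  have "(\<Sum>y\<in>bad. norm (bad_part y)) \<le> (\<Sum>y\<in>bad. norm (\<phi> y) + 2 * s)"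
    unfolding bad_part_def
    by (intro sum_mono order_trans[OF norm_triangle_ineq4] add_left_mono norm_good_part_le)
  also have "\<dots> = (\<Sum>y\<in>bad. norm (\<phi> y)) + 2 * s * real (card bad)"
    by (simp add: sum.distrib)
  also have "\<dots> \<le> ell1_norm \<phi> + 2 * ell1_norm \<phi>"
    using sum_le_ell1_norm[OF \<phi> finite_bad] card_bad_le s by (simp add: pos_le_divide_eq mult_ac)
  finally show ?thesis by simp
qed

end

section \<open>Choice of the subsequence\<close>

lemma pmf_summable_on: "pmf p summable_on A"
proof -
  have "(\<lambda>x. norm (pmf p x)) summable_on A"
    using pmf_abs_summable[of p A] by (simp only: abs_summable_equivalent)
  thus ?thesis by simp
qed

lemma infsum_pmf: "infsum (pmf p) A = measure_pmf.prob p A"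
  using infsetsum_infsum[OF pmf_abs_summable[of p A]] by (simp add: measure_pmf_conv_infsetsum)

lemma pmf_has_sum: "(pmf p has_sum measure_pmf.prob p A) A"
  using has_sum_infsum[OF pmf_summable_on[of p A]] by (simp add: infsum_pmf)

lemma
  fixes f :: "int \<Rightarrow> complex"
  assumes "\<And>j. norm (f j) \<le> C"
  shows summable_on_bounded_times_pmf: "(\<lambda>j. f j * of_real (pmf p j)) summable_on A"
    and norm_infsum_bounded_times_pmf_le:
      "norm (\<Sum>\<^sub>\<infinity>j\<in>A. f j * of_real (pmf p j)) \<le> C * measure_pmf.prob p A"
proof -
  have le: "norm (f j * of_real (pmf p j)) \<le> C * pmf p j" for j
    using assms by (simp add: norm_mult mult_right_mono)
  have hs: "((\<lambda>j. C * pmf p j) has_sum C * measure_pmf.prob p A) A"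
    by (intro has_sum_cmult_right pmf_has_sum)
  show sm: "(\<lambda>j. f j * of_real (pmf p j)) summable_on A"
    by (rule abs_summable_summable, rule summable_on_comparison_test[OF has_sum_imp_summable[OF hs]])
       (use le in auto)
  show "norm (\<Sum>\<^sub>\<infinity>j\<in>A. f j * of_real (pmf p j)) \<le> C * measure_pmf.prob p A"
    using le by (rule norm_infsum_le[OF has_sum_infsum[OF sm] hs])
qed

lemma norm_conv_Z_le:
  assumes "\<And>x. norm (f x) \<le> C"
  shows "norm (conv_Z f p x) \<le> C"
  using norm_infsum_bounded_times_pmf_le[of "\<lambda>j. f (x - j)" C p UNIV] assms
  by (simp add: conv_Z_def)

lemma conv_Z_finite_support:
  fixes b :: "int \<Rightarrow> complex"
  assumes "finite S" "\<And>y. y \<notin> S \<Longrightarrow> b y = 0"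
  shows "((\<lambda>j. b (x - j) * of_real (pmf p j)) has_sum (\<Sum>y\<in>S. b y * of_real (pmf p (x - y)))) UNIV"
proof -
  have "((\<lambda>j. b (x - j) * of_real (pmf p j)) has_sum
         (\<Sum>j\<in>(\<lambda>y. x - y) ` S. b (x - j) * of_real (pmf p j))) ((\<lambda>y. x - y) ` S)"
    using assms by (intro has_sum_finite) auto
  also have "(\<Sum>j\<in>(\<lambda>y. x - y) ` S. b (x - j) * of_real (pmf p j)) = (\<Sum>y\<in>S. b y * of_real (pmf p (x - y)))"
    by (subst sum.reindex) (auto simp: inj_on_def)
  finally show ?thesis
  proof (rule has_sum_cong_neutral[THEN iffD1, rotated -1])
    show "b (x - j) * of_real (pmf p j) = 0" if "j \<in> UNIV - (\<lambda>y. x - y) ` S" for j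
    proof -
      have "x - j \<notin> S" using that by (metis DiffD2 diff_diff_eq2 add_diff_cancel_left' image_eqI)
      thus ?thesis using assms by simp
    qed
  qed auto
qed

text \<open>This is the form in which the decomposition enters: boundedness of the good part and
  finite support of the bad part each make the defining sum converge.\<close>

lemma conv_Z_bounded_plus_finite_support:
  assumes "\<And>x. norm (g x) \<le> C" "finite S" "\<And>y. y \<notin> S \<Longrightarrow> b y = 0"
  shows "conv_Z (\<lambda>x. g x + b x) p x = conv_Z g p x + (\<Sum>y\<in>S. b y * of_real (pmf p (x - y)))"
proof -
  have "(\<lambda>j. g (x - j) * of_real (pmf p j)) summable_on UNIV"
    using assms(1) by (rule summable_on_bounded_times_pmf)
  moreover have "((\<lambda>j. b (x - j) * of_real (pmf p j)) has_sum
      (\<Sum>y\<in>S. b y * of_real (pmf p (x - y)))) UNIV"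
    using assms(2,3) by (rule conv_Z_finite_support)
  ultimately have "((\<lambda>j. g (x - j) * of_real (pmf p j) + b (x - j) * of_real (pmf p j)) has_sum
      ((\<Sum>\<^sub>\<infinity>j. g (x - j) * of_real (pmf p j)) + (\<Sum>y\<in>S. b y * of_real (pmf p (x - y))))) UNIV"
    by (intro has_sum_add has_sum_infsum)
  thus ?thesis by (simp add: conv_Z_def distrib_right infsumI)
qed

text \<open>Characters have modulus 1, so the omitted terms contribute at most the omitted
  mass.\<close>

lemma norm_fourier_Z_minus_truncation_le:
  assumes "finite B"
  shows "norm (fourier_Z p \<gamma> - (\<Sum>j\<in>B. of_real (pmf p j) * e_unit (of_int j * \<gamma>)))
           \<le> measure_pmf.prob p (- B)"
proof -
  let ?f = "\<lambda>j. e_unit (of_int j * \<gamma>) * of_real (pmf p j)"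
  have sm: "?f summable_on A" for A
    by (rule summable_on_bounded_times_pmf[of _ 1]) simp
  have "fourier_Z p \<gamma> = infsum ?f (B \<union> - B)" by (simp add: fourier_Z_def mult.commute)
  also have "\<dots> = infsum ?f B + infsum ?f (- B)" by (intro infsum_Un_disjoint sm) auto
  finally have "fourier_Z p \<gamma> - (\<Sum>j\<in>B. of_real (pmf p j) * e_unit (of_int j * \<gamma>)) = infsum ?f (- B)"
    using assms by (simp add: mult.commute)
  thus ?thesis using norm_infsum_bounded_times_pmf_le[of "\<lambda>j. e_unit (of_int j * \<gamma>)" 1 p "- B"] by simp
qed

lemma norm_fourier_Z_le: "norm (fourier_Z p \<gamma>) \<le> 1"
  using norm_fourier_Z_minus_truncation_le[of "{}" p \<gamma>] by simp

text \<open>Continuity from above: the complements of growing windows decrease to the empty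
  set.\<close>

lemma ex_small_tail:
  fixes p :: "int pmf"
  assumes "\<delta> > 0"
  shows "\<exists>N\<ge>N0. measure_pmf.prob p (- {- int N..int N}) \<le> \<delta>"
proof -
  let ?A = "\<lambda>N. - {- int N..int N}"
  have "(\<Inter>N. ?A N) = {}"
  proof -
    have "x \<in> {- int (nat \<bar>x\<bar>)..int (nat \<bar>x\<bar>)}" for x by auto
    thus ?thesis by blast
  qed
  moreover have "(\<lambda>N. measure_pmf.prob p (?A N)) \<longlonglongrightarrow> measure_pmf.prob p (\<Inter>N. ?A N)"
    by (rule measure_pmf.finite_Lim_measure_decseq) (auto simp: decseq_def)
  ultimately have "(\<lambda>N. measure_pmf.prob p (?A N)) \<longlonglongrightarrow> 0" by simp
  hence "eventually (\<lambda>N. measure_pmf.prob p (?A N) < \<delta>) sequentially"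
    using assms by (rule order_tendstoD)
  then obtain N1 where "\<And>N. N \<ge> N1 \<Longrightarrow> measure_pmf.prob p (?A N) < \<delta>"
    by (auto simp: eventually_sequentially)
  thus ?thesis by (intro exI[of _ "max N0 N1"]) (auto intro: less_imp_le)
qed

text \<open>Near both end points the factor \<open>1 - e_unit \<gamma>\<close> is small and the
  transform is at most 1; on the compact set between them the transform tends to 0
  uniformly.\<close>

lemma eventually_transform_small:
  assumes \<mu>: "asymp_trivial_transforms \<mu>" and \<delta>: "\<delta> > 0"
  shows "\<forall>\<^sub>F n in sequentially. \<forall>\<gamma>\<in>{0..<1}. norm ((1 - e_unit \<gamma>) * fourier_Z (\<mu> n) \<gamma>) \<le> \<delta>"
proof -
  have cont: "isCont (\<lambda>\<gamma>. norm (1 - e_unit \<gamma>)) \<gamma>" for \<gamma>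
    unfolding e_unit_def by (intro continuous_intros)
  have near: "\<exists>\<eta>>0. \<forall>\<gamma>. \<bar>\<gamma> - a\<bar> < \<eta> \<longrightarrow> norm (1 - e_unit \<gamma>) < \<delta>" if "a \<in> \<int>" for a
  proof -
    have "e_unit a = 1" using that by (simp add: e_unit_eq_1_iff)
    hence "((\<lambda>\<gamma>. norm (1 - e_unit \<gamma>)) \<longlongrightarrow> 0) (at a)" using cont[of a] by (simp add: isCont_def)
    from LIM_D[OF this \<delta>] obtain \<eta> where "\<eta> > 0"
      "\<And>\<gamma>. \<gamma> \<noteq> a \<Longrightarrow> \<bar>\<gamma> - a\<bar> < \<eta> \<Longrightarrow> norm (1 - e_unit \<gamma>) < \<delta>" by auto
    thus ?thesis using \<open>e_unit a = 1\<close> \<delta> by (intro exI[of _ \<eta>]) (metis cancel_comm_monoid_add_class.diff_cancel norm_zero)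
  qed
  obtain \<eta>0 where \<eta>0: "\<eta>0 > 0" "\<And>\<gamma>. \<bar>\<gamma> - 0\<bar> < \<eta>0 \<Longrightarrow> norm (1 - e_unit \<gamma>) < \<delta>"
    using near[of 0] by auto
  obtain \<eta>1 where \<eta>1: "\<eta>1 > 0" "\<And>\<gamma>. \<bar>\<gamma> - 1\<bar> < \<eta>1 \<Longrightarrow> norm (1 - e_unit \<gamma>) < \<delta>"
    using near[of 1] by auto
  define K where "K = {\<eta>0..1 - \<eta>1}"
  have "compact K" "K \<subseteq> {0<..<1}" using \<eta>0(1) \<eta>1(1) by (auto simp: K_def)
  hence "uniform_limit K (\<lambda>n. fourier_Z (\<mu> n)) (\<lambda>_. 0) sequentially"
    using \<mu> unfolding asymp_trivial_transforms_def by blast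
  hence "\<forall>\<^sub>F n in sequentially. \<forall>\<gamma>\<in>K. dist (fourier_Z (\<mu> n) \<gamma>) 0 < \<delta> / 2"
    using \<delta> by (intro uniform_limitD) auto
  thus ?thesis
  proof (rule eventually_mono, intro ballI)
    fix n \<gamma> assume far: "\<forall>\<gamma>\<in>K. dist (fourier_Z (\<mu> n) \<gamma>) 0 < \<delta> / 2" and \<gamma>: "\<gamma> \<in> {0..<1::real}"
    show "norm ((1 - e_unit \<gamma>) * fourier_Z (\<mu> n) \<gamma>) \<le> \<delta>"
    proof (cases "\<gamma> \<in> K")
      case True
      \<comment> \<open>This factor 2 is the reason for demanding \<open>\<delta> / 2\<close> on
        \<open>K\<close>.\<close>
      have "norm (1 - e_unit \<gamma>) \<le> 2" using norm_triangle_ineq4[of 1 "e_unit \<gamma>"] by simp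
      moreover have "norm (fourier_Z (\<mu> n) \<gamma>) \<le> \<delta> / 2" using far True by (auto intro: less_imp_le)
      ultimately have "norm (1 - e_unit \<gamma>) * norm (fourier_Z (\<mu> n) \<gamma>) \<le> 2 * (\<delta> / 2)"
        by (intro mult_mono) auto
      thus ?thesis by (simp add: norm_mult)
    next
      case False
      hence "norm (1 - e_unit \<gamma>) < \<delta>" using \<gamma> \<eta>0 \<eta>1 by (cases "\<gamma> < \<eta>0") (auto simp: K_def)
      hence "norm (1 - e_unit \<gamma>) * norm (fourier_Z (\<mu> n) \<gamma>) \<le> \<delta> * 1"
        using norm_fourier_Z_le \<delta> by (intro mult_mono) auto
      thus ?thesis by (simp add: norm_mult)
    qed
  qed
qed

text \<open>\<^term>\<open>N k\<close> is the largest scale at which the transform of \<^term>\<open>\<nu> k\<close> yields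
  cancellation; \<^term>\<open>N (Suc k)\<close> is the radius carrying most of the mass of \<^term>\<open>\<nu> k\<close>.\<close>

definition admissible :: "(nat \<Rightarrow> int pmf) \<Rightarrow> (nat \<Rightarrow> nat) \<Rightarrow> nat \<Rightarrow> bool" where
  "admissible \<nu> N k \<longleftrightarrow> N k \<ge> 1 \<and> N k \<le> N (Suc k) \<and>
     measure_pmf.prob (\<nu> k) (- {- int (N (Suc k))..int (N (Suc k))}) \<le> (1 / 2) ^ k \<and>
     (\<forall>\<gamma>\<in>{0..<1}. norm ((1 - e_unit \<gamma>) *
        (\<Sum>j\<in>{- int (N (Suc k))..int (N (Suc k))}. of_real (pmf (\<nu> k) j) * e_unit (of_int j * \<gamma>)))
          \<le> (1 / 2) ^ k / real (N k))"

text \<open>The index is fixed first, by its full transform, and the window afterwards, by its tail.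
  Of the tolerance, one third covers the transform and two thirds the truncation, whose error is
  multiplied by a factor of at most 2.\<close>

lemma ex_next_index:
  assumes \<mu>: "asymp_trivial_transforms \<mu>" and N: "N \<ge> (1::nat)" and \<delta>: "\<delta> > 0"
  shows "\<exists>n>n0. \<exists>N'\<ge>N. measure_pmf.prob (\<mu> n) (- {- int N'..int N'}) \<le> \<delta> \<and>
     (\<forall>\<gamma>\<in>{0..<1}. norm ((1 - e_unit \<gamma>) *
        (\<Sum>j\<in>{- int N'..int N'}. of_real (pmf (\<mu> n) j) * e_unit (of_int j * \<gamma>))) \<le> \<delta>)"
proof -
  have "\<forall>\<^sub>F n in sequentially. n > n0 \<and>
      (\<forall>\<gamma>\<in>{0..<1}. norm ((1 - e_unit \<gamma>) * fourier_Z (\<mu> n) \<gamma>) \<le> \<delta> / 3)"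
    using \<delta> by (intro eventually_conj eventually_gt_at_top eventually_transform_small[OF \<mu>]) simp
  then obtain n where n: "n > n0"
      "\<And>\<gamma>. \<gamma> \<in> {0..<1} \<Longrightarrow> norm ((1 - e_unit \<gamma>) * fourier_Z (\<mu> n) \<gamma>) \<le> \<delta> / 3"
    by (auto simp: eventually_sequentially)
  obtain N' where N': "N' \<ge> N" "measure_pmf.prob (\<mu> n) (- {- int N'..int N'}) \<le> \<delta> / 3"
    using ex_small_tail[of "\<delta> / 3" N "\<mu> n"] \<delta> by auto
  have "norm ((1 - e_unit \<gamma>) * (\<Sum>j\<in>{- int N'..int N'}. of_real (pmf (\<mu> n) j) * e_unit (of_int j * \<gamma>))) \<le> \<delta>"
    (is "norm (_ * ?T) \<le> _") if "\<gamma> \<in> {0..<1}" for \<gamma>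
  proof -
    have "norm (1 - e_unit \<gamma>) \<le> 2" using norm_triangle_ineq4[of 1 "e_unit \<gamma>"] by simp
    moreover have "norm (fourier_Z (\<mu> n) \<gamma> - ?T) \<le> \<delta> / 3"
      using norm_fourier_Z_minus_truncation_le N'(2) order_trans by blast
    ultimately have "norm ((1 - e_unit \<gamma>) * (fourier_Z (\<mu> n) \<gamma> - ?T)) \<le> 2 * (\<delta> / 3)"
      unfolding norm_mult by (intro mult_mono) auto
    moreover have "norm ((1 - e_unit \<gamma>) * ?T) =
        norm ((1 - e_unit \<gamma>) * fourier_Z (\<mu> n) \<gamma> - (1 - e_unit \<gamma>) * (fourier_Z (\<mu> n) \<gamma> - ?T))"
      by (simp add: algebra_simps)
    ultimately show ?thesis
      using n(2)[OF that] norm_triangle_ineq4[of "(1 - e_unit \<gamma>) * fourier_Z (\<mu> n) \<gamma>"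
        "(1 - e_unit \<gamma>) * (fourier_Z (\<mu> n) \<gamma> - ?T)"] by linarith
  qed
  thus ?thesis using n(1) N' \<delta> by (intro exI[of _ n] exI[of _ N'] conjI) auto
qed

text \<open>The choices alternate: \<open>N k\<close> is known when the index \<open>r k\<close> is
  picked, so the transform can be made small relative to it, and \<open>N (Suc k)\<close> is then
  taken large enough for the chosen measure.\<close>

lemma ex_admissible_subsequence:
  assumes \<mu>: "asymp_trivial_transforms \<mu>"
  shows "\<exists>r N. strict_mono r \<and> (\<forall>k. admissible (\<lambda>k. \<mu> (r k)) N k)"
proof -
  define good where "good k N n N' \<longleftrightarrow> N \<le> N' \<and>
     measure_pmf.prob (\<mu> n) (- {- int N'..int N'}) \<le> (1 / 2) ^ k \<and>
     (\<forall>\<gamma>\<in>{0..<1}. norm ((1 - e_unit \<gamma>) *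
        (\<Sum>j\<in>{- int N'..int N'}. of_real (pmf (\<mu> n) j) * e_unit (of_int j * \<gamma>)))
          \<le> (1 / 2) ^ k / real N)" for k and N n N' :: nat
  have ex: "\<exists>n>n0. \<exists>N'. good k N n N'" if "N \<ge> 1" for n0 N k :: nat
  proof -
    \<comment> \<open>One tolerance serves both demands, since the bound wanted for the transform is
      the stricter one.\<close>
    have "(1 / 2 :: real) ^ k / real N \<le> (1 / 2) ^ k"
      using that by (simp add: field_simps)
    moreover have "(1 / 2 :: real) ^ k / real N > 0" using that by simp
    ultimately show ?thesis
      using ex_next_index[OF \<mu> that, of "(1 / 2) ^ k / real N" n0] unfolding good_def
      by (meson order_trans)
  qed
  \<comment> \<open>The state of the recursion is the current scale, the chosen index and the next
    scale; \<open>Q\<close> passes the last on as the new current scale.\<close>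
  define P where "P k s \<longleftrightarrow> (case s of (N, n, N') \<Rightarrow> N \<ge> 1 \<and> good k N n N')"
    for k :: nat and s :: "nat \<times> nat \<times> nat"
  define Q where "Q s s' \<longleftrightarrow> (case (s, s') of ((N, n, N'), (M, m, M')) \<Rightarrow> n < m \<and> M = N')"
    for s s' :: "nat \<times> nat \<times> nat"
  have "\<exists>f. \<forall>k. P k (f k) \<and> Q (f k) (f (Suc k))"
  proof (rule dependent_nat_choice)
    show "\<exists>s. P 0 s" using ex[of 1 0 0] by (auto simp: P_def)
    show "\<exists>s'. P (Suc k) s' \<and> Q s s'" if "P k s" for s k
    proof -
      obtain N n N' where s: "s = (N, n, N')" by (cases s)
      hence "N' \<ge> 1" using that by (auto simp: P_def good_def)
      from ex[OF this, of n "Suc k"] show ?thesis using \<open>N' \<ge> 1\<close> by (auto simp: P_def Q_def s)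
    qed
  qed
  then obtain f where f: "\<And>k. P k (f k)" "\<And>k. Q (f k) (f (Suc k))" by blast
  define N where "N k = fst (f k)" for k
  define r where "r k = fst (snd (f k))" for k
  have step: "r k < r (Suc k)" "snd (snd (f k)) = N (Suc k)" for k
    using f(2)[of k] by (auto simp: Q_def N_def r_def split: prod.splits)
  have "admissible (\<lambda>k. \<mu> (r k)) N k" for k
    using f(1)[of k] step(2)[of k]
    by (auto simp: P_def good_def admissible_def N_def r_def split: prod.splits)
  moreover have "strict_mono r" using step by (simp add: strict_mono_Suc_iff)
  ultimately show ?thesis by blast
qed

section \<open>The weak type bound\<close>

lemma sum_half_power_le: "(\<Sum>k<K. (1 / 2 :: real) ^ k) \<le> 2"
proof -
  have "(\<Sum>k<K. (1 / 2 :: real) ^ k) = ((1 / 2) ^ K - 1) / (1 / 2 - 1)"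
    by (rule geometric_sum) simp
  also have "\<dots> \<le> 2" by (simp add: field_simps)
  finally show ?thesis .
qed

lemma sum_pmf_shift_le:
  fixes p :: "int pmf"
  assumes "finite X"
  shows "(\<Sum>x\<in>X. if x - y \<in> A then pmf p (x - y) else 0) \<le> measure_pmf.prob p A"
proof -
  have "(\<Sum>x\<in>X. if x - y \<in> A then pmf p (x - y) else 0) = (\<Sum>x\<in>{x \<in> X. x - y \<in> A}. pmf p (x - y))"
    using assms by (simp add: sum.inter_filter)
  also have "\<dots> = (\<Sum>z\<in>(\<lambda>x. x - y) ` {x \<in> X. x - y \<in> A}. pmf p z)"
    by (subst sum.reindex) (auto simp: inj_on_def)
  also have "\<dots> = measure_pmf.prob p ((\<lambda>x. x - y) ` {x \<in> X. x - y \<in> A})"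
    using assms by (simp add: measure_measure_pmf_finite)
  also have "\<dots> \<le> measure_pmf.prob p A"
    by (intro measure_pmf.finite_measure_mono) auto
  finally show ?thesis .
qed

text \<open>Markov's inequality for counting measure.\<close>

lemma card_superlevel_le:
  fixes F :: "'a \<Rightarrow> real"
  assumes "finite X" "\<And>x. x \<in> X \<Longrightarrow> F x \<ge> 0"
  shows "c * real (card {x \<in> X. F x > c}) \<le> (\<Sum>x\<in>X. F x)"
proof -
  have "c * real (card {x \<in> X. F x > c}) = (\<Sum>x\<in>{x \<in> X. F x > c}. c)" by simp
  also have "\<dots> \<le> (\<Sum>x\<in>{x \<in> X. F x > c}. F x)" by (rule sum_mono) auto
  also have "\<dots> \<le> (\<Sum>x\<in>X. F x)" using assms by (intro sum_mono2) auto
  finally show ?thesis .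
qed

lemma admissible_mono:
  assumes "\<And>k. admissible \<nu> N k"
  shows "mono N"
  unfolding mono_iff_le_Suc
proof
  show "N k \<le> N (Suc k)" for k using assms[of k] by (simp only: admissible_def)
qed

text \<open>Consecutive scales bound disjoint half-open ranges. Hence a cube is of intermediate size
  for at most one measure, where the trivial bound is affordable.\<close>

lemma card_scale_le:
  fixes N :: "nat \<Rightarrow> nat" and L :: nat
  assumes "mono N"
  shows "card {k. k < K \<and> N k < L \<and> L \<le> N (Suc k)} \<le> 1"
proof -
  have "i = j" if "N i < L" "L \<le> N (Suc i)" "N j < L" "L \<le> N (Suc j)" for i j
  proof (rule ccontr)
    assume "i \<noteq> j"
    hence "Suc i \<le> j \<or> Suc j \<le> i" by auto
    thus False using that monoD[OF assms, of "Suc i" j] monoD[OF assms, of "Suc j" i] by auto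
  qed
  thus ?thesis by (auto simp: card_le_Suc0_iff_eq)
qed

section \<open>Estimates at a fixed height along an admissible subsequence\<close>

context calderon_zygmund
begin

context
  fixes \<nu> :: "nat \<Rightarrow> int pmf" and N :: "nat \<Rightarrow> nat"
  assumes adm: "\<And>k. admissible \<nu> N k"
begin

definition window :: "nat \<Rightarrow> int set" where
  "window k = {- int (N (Suc k))..int (N (Suc k))}"

definition truncated :: "nat \<Rightarrow> int \<Rightarrow> complex" where
  "truncated k z = (if z \<in> window k then of_real (pmf (\<nu> k) z) else 0)"

definition small :: "nat \<Rightarrow> int set" where
  "small k = {y \<in> bad. 2 ^ level y \<le> N k}"

text \<open>The first summand accounts for truncating the measure, and for the cubes larger than its window;
  the second one for the cubes of intermediate size.\<close>

definition kernel :: "nat \<Rightarrow> int \<Rightarrow> int \<Rightarrow> real" where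
  "kernel k y z = (if z \<in> - window k then pmf (\<nu> k) z else 0) +
     (if N k < 2 ^ level y \<and> 2 ^ level y \<le> N (Suc k) then pmf (\<nu> k) z else 0)"

definition small_conv :: "nat \<Rightarrow> int \<Rightarrow> complex" where
  "small_conv k x = (\<Sum>y\<in>small k. bad_part y * truncated k (x - y))"

text \<open>Summing over \<open>k\<close> gives a single function that dominates the remainders of
  all the measures at once and can be summed over \<open>x\<close>.\<close>

definition majorant :: "nat \<Rightarrow> int \<Rightarrow> real" where
  "majorant K x = (\<Sum>k<K. \<Sum>y\<in>bad. norm (bad_part y) * kernel k y (x - y))"

lemma kernel_nonneg: "0 \<le> kernel k y z"
  by (simp add: kernel_def)

lemma majorant_nonneg: "0 \<le> majorant K x"
  unfolding majorant_def by (intro sum_nonneg mult_nonneg_nonneg kernel_nonneg) auto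

text \<open>The good part gives \<open>2 * s\<close>. The bad part splits into small cubes against
  the truncated measure and a remainder \<open>R\<close>; away from \<open>enlarged\<close>,
  \<open>R\<close> is dominated by the kernel.\<close>

lemma norm_conv_le:
  assumes x: "x \<notin> enlarged" and k: "k < K"
  shows "norm (conv_Z \<phi> (\<nu> k) x) \<le> 2 * s + norm (small_conv k x) + majorant K x"
proof -
  let ?p = "\<lambda>z. complex_of_real (pmf (\<nu> k) z)"
  let ?t = "\<lambda>y. if y \<in> small k then truncated k (x - y) else 0"
  define R where "R = (\<Sum>y\<in>bad. bad_part y * (?p (x - y) - ?t y))"
  have sub: "small k \<subseteq> bad" by (auto simp: small_def)
  have "conv_Z \<phi> (\<nu> k) x = conv_Z good_part (\<nu> k) x + (\<Sum>y\<in>bad. bad_part y * ?p (x - y))"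
  proof -
    have "conv_Z (\<lambda>x. good_part x + bad_part x) (\<nu> k) x =
        conv_Z good_part (\<nu> k) x + (\<Sum>y\<in>bad. bad_part y * ?p (x - y))"
      by (rule conv_Z_bounded_plus_finite_support[OF _ finite_bad])
         (rule norm_good_part_le, rule bad_part_eq_0)
    thus ?thesis by (simp add: bad_part_def)
  qed
  moreover have "(\<Sum>y\<in>bad. bad_part y * ?p (x - y)) =
      small_conv k x + R"
  proof -
    have "small_conv k x = (\<Sum>y\<in>bad. bad_part y * ?t y)"
      unfolding small_conv_def using finite_bad sub by (intro sum.mono_neutral_cong_left) auto
    thus ?thesis unfolding R_def by (simp only: right_diff_distrib sum_subtractf) simp
  qed
  ultimately have decomp: "conv_Z \<phi> (\<nu> k) x = conv_Z good_part (\<nu> k) x + (small_conv k x + R)"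
    by simp
  have R: "norm R \<le> majorant K x"
  proof -
    have "norm R \<le> (\<Sum>y\<in>bad. norm (bad_part y) * kernel k y (x - y))"
      unfolding R_def
    proof (rule sum_norm_le)
      fix y assume y: "y \<in> bad"
      have far: "\<bar>x - y\<bar> > 2 ^ level y" using x y by (force simp: enlarged_def)
      have "norm (?p (x - y) - ?t y) \<le> kernel k y (x - y)"
      proof (cases "N (Suc k) < 2 ^ level y")
        \<comment> \<open>The cube is longer than the window, and \<open>x\<close> is farther than a
          cube length from \<open>y\<close>, so only the tail of the measure is felt.\<close>
        case True
        hence "int (N (Suc k)) < 2 ^ level y" by (metis of_nat_less_iff of_nat_numeral of_nat_power)
        hence "int (N (Suc k)) < \<bar>x - y\<bar>" using far by (rule less_trans)
        hence "x - y \<notin> window k" unfolding window_def atLeastAtMost_iff by linarith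
        thus ?thesis by (simp add: kernel_def truncated_def)
      next
        case False
        \<comment> \<open>For a small cube only the truncation error is left; otherwise the cube is
          intermediate and the second summand of the kernel pays for it.\<close>
        thus ?thesis using y by (auto simp: kernel_def truncated_def small_def not_less)
      qed
      thus "norm (bad_part y * (?p (x - y) - ?t y)) \<le> norm (bad_part y) * kernel k y (x - y)"
        by (simp add: norm_mult mult_left_mono)
    qed
    also have "\<dots> \<le> majorant K x"
      unfolding majorant_def using k
      by (intro member_le_sum[of k _ "\<lambda>k. \<Sum>y\<in>bad. norm (bad_part y) * kernel k y (x - y)"]
            sum_nonneg mult_nonneg_nonneg kernel_nonneg) auto
    finally show ?thesis .
  qed
  have "norm (conv_Z good_part (\<nu> k) x + (small_conv k x + R)) \<le>
      2 * s + (norm (small_conv k x) + norm R)"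
    by (intro norm_triangle_mono norm_conv_Z_le norm_good_part_le norm_triangle_ineq)
  with R show ?thesis unfolding decomp by linarith
qed

text \<open>The primitive is at most \<open>4 * s * N k\<close> on at most
  \<open>ell1_norm \<phi> / s\<close> points, and the factor \<open>1 / N k\<close> in the transform
  bound cancels the scale.\<close>

lemma sum_small_conv_le:
  assumes X: "finite X"
  shows "(\<Sum>x\<in>X. (norm (small_conv k x))\<^sup>2) \<le> 16 * s * ell1_norm \<phi> * (1 / 2) ^ k"
proof -
  let ?b = "\<lambda>y. if y \<in> small k then bad_part y else 0"
  let ?h = "\<lambda>y. if y \<in> small k then primitive y else 0"
  let ?\<delta> = "(1 / 2) ^ k / real (N k)"
  have fin: "finite (small k)" using finite_bad by (simp add: small_def)
  have N: "N k \<ge> 1" using adm[of k] by (simp add: admissible_def)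
  have "(\<Sum>x\<in>X. (norm (small_conv k x))\<^sup>2) = (\<Sum>x\<in>X. (norm (\<Sum>y\<in>small k. ?b y * truncated k (x - y)))\<^sup>2)"
    by (simp add: small_conv_def)
  also have "\<dots> \<le> ?\<delta>\<^sup>2 * (\<Sum>y\<in>small k. (norm (?h y))\<^sup>2)"
  proof (rule l2_difference_convolution_bound[OF fin _ X, where B = "window k"])
    show "?b y = ?h y - ?h (y - 1)" for y
      using primitive_diff[of y "\<lambda>l. 2 ^ l \<le> N k"] by (simp add: small_def)
    show "norm ((1 - e_unit \<gamma>) * (\<Sum>z\<in>window k. truncated k z * e_unit (of_int z * \<gamma>))) \<le> ?\<delta>"
      if "\<gamma> \<in> {0..<1}" for \<gamma>
      using adm[of k] that by (simp add: admissible_def truncated_def window_def)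
  qed (auto simp: window_def truncated_def)
  also have "\<dots> \<le> ?\<delta>\<^sup>2 * (\<Sum>y\<in>small k. (4 * s * real (N k))\<^sup>2)"
  proof (intro mult_left_mono sum_mono power_mono)
    fix y assume y: "y \<in> small k"
    hence "norm (?h y) \<le> 4 * s * 2 ^ level y"
      using norm_primitive_le by (simp add: small_def)
    also have "\<dots> \<le> 4 * s * real (N k)"
    proof -
      have "real (2 ^ level y) \<le> real (N k)" using y by (simp only: small_def of_nat_le_iff) simp
      thus ?thesis using s by simp
    qed
    finally show "norm (?h y) \<le> 4 * s * real (N k)" .
  qed auto
  also have "\<dots> = 16 * s\<^sup>2 * real (card (small k)) * ((1 / 2) ^ k)\<^sup>2"
    using N by (simp add: power_mult_distrib power_divide field_simps)
  also have "\<dots> \<le> 16 * s\<^sup>2 * (ell1_norm \<phi> / s) * (1 / 2) ^ k"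
  proof (intro mult_mono mult_left_mono)
    have "card (small k) \<le> card bad" using finite_bad by (intro card_mono) (auto simp: small_def)
    thus "real (card (small k)) \<le> ell1_norm \<phi> / s" using card_bad_le by linarith
    \<comment> \<open>The decay \<open>(1 / 4) ^ k\<close> is relaxed to \<open>(1 / 2) ^ k\<close>,
      so that the same geometric series bound applies throughout.\<close>
    have "(1 / 2 :: real) ^ k * (1 / 2) ^ k \<le> (1 / 2) ^ k * 1"
      by (intro mult_left_mono power_le_one) auto
    thus "((1 / 2 :: real) ^ k)\<^sup>2 \<le> (1 / 2) ^ k" by (simp add: power2_eq_square)
    show "0 \<le> 16 * s\<^sup>2 * (ell1_norm \<phi> / s)"
      using s by (simp add: ell1_norm_def infsum_nonneg)
  qed auto
  also have "\<dots> = 16 * s * ell1_norm \<phi> * (1 / 2) ^ k"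
    using s by (simp add: power2_eq_square)
  finally show ?thesis .
qed

text \<open>For each bad point the kernels have total mass at most 3: the tails sum to at most 2,
  and the intermediate case adds at most 1. The bad part has norm at most three times that of
  \<open>\<phi>\<close>.\<close>

lemma sum_majorant_le:
  assumes X: "finite X"
  shows "(\<Sum>x\<in>X. majorant K x) \<le> 9 * ell1_norm \<phi>"
proof -
  let ?mid = "\<lambda>k y. N k < 2 ^ level y \<and> 2 ^ level y \<le> N (Suc k)"
  have mass: "(\<Sum>x\<in>X. kernel k y (x - y)) \<le> (1 / 2) ^ k + (if ?mid k y then 1 else 0)" for k y
  proof -
    have "(\<Sum>x\<in>X. kernel k y (x - y)) = (\<Sum>x\<in>X. if x - y \<in> - window k then pmf (\<nu> k) (x - y) else 0) +
        (if ?mid k y then \<Sum>x\<in>X. if x - y \<in> UNIV then pmf (\<nu> k) (x - y) else 0 else 0)"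
      unfolding kernel_def sum.distrib
      by (cases "?mid k y") (simp_all only: if_True if_False simp_thms UNIV_I sum.neutral_const)
    also have "\<dots> \<le> measure_pmf.prob (\<nu> k) (- window k) +
        (if ?mid k y then measure_pmf.prob (\<nu> k) UNIV else 0)"
      using sum_pmf_shift_le[OF X, of y "- window k" "\<nu> k"] sum_pmf_shift_le[OF X, of y UNIV "\<nu> k"]
      by (intro add_mono) auto
    also have "\<dots> \<le> (1 / 2) ^ k + (if ?mid k y then 1 else 0)"
      using adm[of k] by (simp add: admissible_def window_def)
    finally show ?thesis .
  qed
  have total: "(\<Sum>k<K. \<Sum>x\<in>X. kernel k y (x - y)) \<le> 3" for y
  proof -
    have "(\<Sum>k<K. if ?mid k y then 1 else 0) = real (card {k \<in> {..<K}. ?mid k y})"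
      by (simp add: sum.inter_filter[symmetric])
    also have "\<dots> \<le> 1"
      using card_scale_le[OF admissible_mono[OF adm], of K "2 ^ level y"] by simp
    finally have "(\<Sum>k<K. if ?mid k y then 1 else (0::real)) \<le> 1" .
    hence "(\<Sum>k<K. (1 / 2) ^ k + (if ?mid k y then 1 else (0::real))) \<le> 2 + 1"
      unfolding sum.distrib using sum_half_power_le by (intro add_mono)
    moreover have "(\<Sum>k<K. \<Sum>x\<in>X. kernel k y (x - y)) \<le>
        (\<Sum>k<K. (1 / 2) ^ k + (if ?mid k y then 1 else 0))"
      by (intro sum_mono mass)
    ultimately show ?thesis by linarith
  qed
  have "(\<Sum>x\<in>X. majorant K x) = (\<Sum>k<K. \<Sum>x\<in>X. \<Sum>y\<in>bad. norm (bad_part y) * kernel k y (x - y))"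
    unfolding majorant_def by (rule sum.swap)
  also have "\<dots> = (\<Sum>k<K. \<Sum>y\<in>bad. \<Sum>x\<in>X. norm (bad_part y) * kernel k y (x - y))"
    by (intro sum.cong refl sum.swap)
  also have "\<dots> = (\<Sum>y\<in>bad. \<Sum>k<K. \<Sum>x\<in>X. norm (bad_part y) * kernel k y (x - y))"
    by (rule sum.swap)
  also have "\<dots> = (\<Sum>y\<in>bad. norm (bad_part y) * (\<Sum>k<K. \<Sum>x\<in>X. kernel k y (x - y)))"
    by (simp add: sum_distrib_left)
  also have "\<dots> \<le> (\<Sum>y\<in>bad. norm (bad_part y) * 3)"
    by (intro sum_mono mult_left_mono total) auto
  also have "\<dots> \<le> 9 * ell1_norm \<phi>"
    using sum_norm_bad_part_le by (simp add: sum_distrib_right[symmetric])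
  finally show ?thesis .
qed

text \<open>The height \<open>4 * s\<close> splits as \<open>2 * s\<close> for the good part and
  \<open>s\<close> each for the small cubes and the majorant. The constant is 3 for
  \<open>enlarged\<close>, 32 for the square function and 9 for the majorant.\<close>

lemma card_finite_superlevel_le:
  assumes X: "finite X" and big: "\<And>x. x \<in> X \<Longrightarrow> \<exists>k. norm (conv_Z \<phi> (\<nu> k) x) > 4 * s"
  shows "real (card X) \<le> 44 * ell1_norm \<phi> / s"
proof -
  obtain \<kappa> where \<kappa>: "\<And>x. x \<in> X \<Longrightarrow> norm (conv_Z \<phi> (\<nu> (\<kappa> x)) x) > 4 * s"
    using big by metis
  \<comment> \<open>Finiteness of \<open>X\<close> leaves finitely many witnesses, so the supremum
    over \<open>k\<close> becomes a finite range.\<close>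
  obtain K where K: "\<And>x. x \<in> X \<Longrightarrow> \<kappa> x < K"
    using finite_nat_bounded[of "\<kappa> ` X"] X by auto
  \<comment> \<open>A square function replaces the maximum over \<open>k\<close>, so the bounds in
    mean square can simply be added.\<close>
  define square where "square x = (\<Sum>k<K. (norm (small_conv k x))\<^sup>2)" for x
  define X1 where "X1 = {x \<in> X. square x > s\<^sup>2}"
  define X2 where "X2 = {x \<in> X. majorant K x > s}"
  have cover: "X \<subseteq> enlarged \<union> X1 \<union> X2"
  proof
    fix x assume x: "x \<in> X"
    show "x \<in> enlarged \<union> X1 \<union> X2"
    proof (rule ccontr)
      assume "x \<notin> enlarged \<union> X1 \<union> X2"
      hence no: "x \<notin> enlarged" "square x \<le> s\<^sup>2" "majorant K x \<le> s"
        using x by (auto simp: X1_def X2_def)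
      have "(norm (small_conv (\<kappa> x) x))\<^sup>2 \<le> square x"
        unfolding square_def using K[OF x]
        by (intro member_le_sum[of "\<kappa> x" _ "\<lambda>k. (norm (small_conv k x))\<^sup>2"]) auto
      also note no(2)
      finally have "norm (small_conv (\<kappa> x) x) \<le> s"
        by (rule power2_le_imp_le) (use s in simp)
      thus False using norm_conv_le[OF no(1) K[OF x]] \<kappa>[OF x] no(3) by linarith
    qed
  qed
  have "s\<^sup>2 * real (card X1) \<le> (\<Sum>x\<in>X. square x)"
    unfolding X1_def by (intro card_superlevel_le X) (simp add: square_def sum_nonneg)
  also have "\<dots> = (\<Sum>k<K. \<Sum>x\<in>X. (norm (small_conv k x))\<^sup>2)"
    unfolding square_def by (rule sum.swap)
  also have "\<dots> \<le> (\<Sum>k<K. 16 * s * ell1_norm \<phi> * (1 / 2) ^ k)"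
    by (intro sum_mono sum_small_conv_le X)
  also have "\<dots> \<le> 16 * s * ell1_norm \<phi> * 2"
    unfolding sum_distrib_left[symmetric] using s
    by (intro mult_left_mono sum_half_power_le) (simp add: ell1_norm_def infsum_nonneg)
  finally have X1: "real (card X1) \<le> 32 * ell1_norm \<phi> / s"
    using s by (simp add: field_simps power2_eq_square)
  have "s * real (card X2) \<le> (\<Sum>x\<in>X. majorant K x)"
    unfolding X2_def by (intro card_superlevel_le X majorant_nonneg)
  also have "\<dots> \<le> 9 * ell1_norm \<phi>" by (rule sum_majorant_le[OF X])
  finally have X2: "real (card X2) \<le> 9 * ell1_norm \<phi> / s"
    using s by (simp add: field_simps)
  have "card X \<le> card (enlarged \<union> X1 \<union> X2)"
    using cover finite_enlarged X by (intro card_mono) (auto simp: X1_def X2_def)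
  also have "\<dots> \<le> card enlarged + card X1 + card X2"
    by (intro order_trans[OF card_Un_le] add_mono card_Un_le order_refl)
  finally have "real (card X) \<le> real (card enlarged) + real (card X1) + real (card X2)"
    by linarith
  thus ?thesis using card_enlarged_le X1 X2 by (simp add: field_simps)
qed

end

end

theorem theorem1p3:
  fixes \<mu> :: "nat \<Rightarrow> int pmf"
  assumes "asymp_trivial_transforms \<mu>"
  shows "\<exists>(r :: nat \<Rightarrow> nat) (C :: real). strict_mono r \<and>
    (\<forall>\<phi> \<in> ell1_Z. \<forall>t::real. t > 0 \<longrightarrow>
       finite {x :: int. maximal_fun (\<lambda>k. \<mu> (r k)) \<phi> x > ereal t} \<and>
       real (card {x :: int. maximal_fun (\<lambda>k. \<mu> (r k)) \<phi> x > ereal t})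
         \<le> C * inverse t * ell1_norm \<phi>)"
proof -
  obtain r N where r: "strict_mono r" and adm: "\<And>k. admissible (\<lambda>k. \<mu> (r k)) N k"
    using ex_admissible_subsequence[OF assms] by blast
  have "finite {x. maximal_fun (\<lambda>k. \<mu> (r k)) \<phi> x > ereal t} \<and>
      real (card {x. maximal_fun (\<lambda>k. \<mu> (r k)) \<phi> x > ereal t}) \<le> 176 * inverse t * ell1_norm \<phi>"
    (is "finite ?E \<and> _") if \<phi>: "\<phi> \<in> ell1_Z" and t: "t > 0" for \<phi> t
  proof -
    \<comment> \<open>The height \<open>t / 4\<close> turns the threshold \<open>4 * s\<close> into
      \<open>t\<close>, and the constant 44 into 176.\<close>
    interpret calderon_zygmund \<phi> "t / 4"
      using \<phi> t by unfold_locales auto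
    have bound: "real (card X) \<le> 176 * inverse t * ell1_norm \<phi>" if X: "X \<subseteq> ?E" "finite X" for X
    proof -
      have "\<exists>k. norm (conv_Z \<phi> (\<mu> (r k)) x) > 4 * (t / 4)" if "x \<in> X" for x
      proof -
        have "ereal t < (SUP k. ereal (norm (conv_Z \<phi> (\<mu> (r k)) x)))"
          using that X by (auto simp: maximal_fun_def)
        thus ?thesis by (auto simp: less_SUP_iff)
      qed
      from card_finite_superlevel_le[OF adm X(2) this] show ?thesis
        by (simp add: field_simps)
    qed
    \<comment> \<open>A bound uniform over finite subsets gives both finiteness of the superlevel
      set and its cardinality.\<close>
    have "finite ?E \<and> card ?E \<le> nat \<lfloor>176 * inverse t * ell1_norm \<phi>\<rfloor>"
      by (rule finite_if_finite_subsets_card_bdd) (use bound in \<open>fastforce simp: le_nat_floor\<close>)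
    thus ?thesis using bound by blast
  qed
  thus ?thesis using r by blast
qed

end
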